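(* The center $\mathrm{Z}(\mathbb{T})$ of $\mathbb{T}$ has the $\mathbb{F}$-basis $\{C_{\mathbf a}: (\mathbf 1,\mathbf a,\mathbf 1)\in\mathbb{P}\}$, and this basis has cardinality $2^{n_2}$.
   Context: Let $\mathbb{F}$ be a field of characteristic $p\ge 0$; for an integer $m$, $\overline{m}$ denotes its image in $\mathbb{F}$. Let $n\ge 1$ and let $U_1,\dots,U_n$ be finite sets with $|U_h|\ge 2$ for all $h$. Put $X=U_1\times\cdots\times U_n$ and $E=\{0,1\}^n$. For $\mathbf g\in E$ let $S(\mathbf g)=\{a\in\{1,\dots,n\}:\mathbf g_a=1\}$ (so $\mathbf g\mapsto S(\mathbf g)$ is a bijection from $E$ onto the subsets of $\{1,\dots,n\}$); $\mathbf 0,\mathbf 1$ are the all-zero and all-one tuples; $\mathbf g\cap\mathbf h$ and $\mathbf g\setminus\mathbf h$ denote the elements of $E$ with supports $S(\mathbf g)\cap S(\mathbf h)$ and $S(\mathbf g)\setminus S(\mathbf h)$. For $V\subseteq\{1,\dots,n\}$ let $V^\circ=\{a\in V:|U_a|>2\}$. For $\mathbf g\in E$ let $R_{\mathbf g}=\{(\mathbf y,\mathbf z)\in X\times X:\ \mathbf y_a\neq\mathbf z_a \iff \mathbf g_a=1\}$ (this is the factorial scheme, the direct product of the trivial schemes on $U_1,\dots,U_n$), and $k_{\mathbf g}=\prod_{a\in S(\mathbf g)}(|U_a|-1)$ (with $k_{\mathbf 0}=1$). Let $A_{\mathbf g}$ be the $\{0,1\}$ adjacency matrix of $R_{\mathbf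 g}$ in the full matrix algebra $\mathrm{M}_X(\mathbb{F})$. Fix $\mathbf x\in X$ and let $E^*_{\mathbf g}$ be the diagonal matrix in $\mathrm{M}_X(\mathbb{F})$ whose $(\mathbf y,\mathbf y)$-entry is $\overline 1$ iff $(\mathbf x,\mathbf y)\in R_{\mathbf g}$ and $\overline 0$ otherwise. Let $\mathbb{T}$ be the $\mathbb{F}$-subalgebra of $\mathrm{M}_X(\mathbb{F})$ generated by all $A_{\mathbf g}$ and $E^*_{\mathbf g}$ ($\mathbf g\in E$). Let $n_2=|\{a:|U_a|>2\}|$. Let $\mathbb{P}$ be the set of triples $(\mathbf a,\mathbf b,\mathbf c)\in E^3$ with $S(\mathbf a)\triangle S(\mathbf c)\subseteq S(\mathbf b)\subseteq (S(\mathbf a)\triangle S(\mathbf c))\cup(S(\mathbf a)\cap S(\mathbf c))^\circ$. For $(\mathbf g,\mathbf h,\mathbf i)\in\mathbb{P}$ let $B_{\mathbf g,\mathbf h,\mathbf i}=\sum_{\mathbf j}E^*_{\mathbf g}A_{\mathbf j}E^*_{\mathbf i}$, the sum over all $\mathbf j\in E$ with $S(\mathbf g)\triangle S(\mathbf i)\subseteq S(\mathbf j)\subseteq S(\mathbf h)$. For $\mathbf g\in E$ with $(\mathbf 1,\mathbf g,\mathbf 1)\in\mathbb{P}$ (i.e. $S(\mathbf g)\subseteq\{a:|U_a|>2\}$), define $C_{\mathbf g}=\sum_{\mathbf h\in E}\overline{k_{\mathbf g\setminus\mathbf h}}\,B_{\mathbf h,\mathbf g\cap\mathbf h,\mathbf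 h}$. *)

theory Defs
  imports Complex_Main "HOL-Library.FuncSet" "HOL-Library.Function_Algebras"
begin

text \<open>
  The sets \<open>U\<^sub>1, \<dots>, U\<^sub>n\<close> are given by a family \<open>U\<close>, of which only the members with index in
  \<open>{1..n}\<close> matter.  Tuples are extensional functions on \<open>{1..n}\<close>.
\<close>

definition points :: "nat \<Rightarrow> (nat \<Rightarrow> 'u set) \<Rightarrow> (nat \<Rightarrow> 'u) set" where
  "points n U = (\<Pi>\<^sub>E a\<in>{1..n}. U a)"

definition tuples01 :: "nat \<Rightarrow> (nat \<Rightarrow> nat) set" where
  "tuples01 n = (\<Pi>\<^sub>E a\<in>{1..n}. {0, 1})"

definition supp :: "nat \<Rightarrow> (nat \<Rightarrow> nat) \<Rightarrow> nat set" where
  "supp n g = {a \<in> {1..n}. g a = 1}"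

definition tuple_of :: "nat \<Rightarrow> nat set \<Rightarrow> (nat \<Rightarrow> nat)" where
  "tuple_of n V = (\<lambda>a\<in>{1..n}. if a \<in> V then 1 else 0)"

lemma supp_tuple_of: "V \<subseteq> {1..n} \<Longrightarrow> supp n (tuple_of n V) = V"
  by (auto simp: supp_def tuple_of_def)

lemma tuple_of_in_tuples01: "tuple_of n V \<in> tuples01 n"
  by (auto simp: tuple_of_def tuples01_def)

lemma tuple_of_supp: "g \<in> tuples01 n \<Longrightarrow> tuple_of n (supp n g) = g"
  by (fastforce simp: supp_def tuple_of_def tuples01_def PiE_iff extensional_def fun_eq_iff)

definition ones :: "nat \<Rightarrow> (nat \<Rightarrow> nat)" where
  "ones n = (\<lambda>a\<in>{1..n}. 1)"

definition meet01 :: "nat \<Rightarrow> (nat \<Rightarrow> nat) \<Rightarrow> (nat \<Rightarrow> nat) \<Rightarrow> (nat \<Rightarrow> nat)" where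
  "meet01 n g h = tuple_of n (supp n g \<inter> supp n h)"

definition diff01 :: "nat \<Rightarrow> (nat \<Rightarrow> nat) \<Rightarrow> (nat \<Rightarrow> nat) \<Rightarrow> (nat \<Rightarrow> nat)" where
  "diff01 n g h = tuple_of n (supp n g - supp n h)"

text \<open>\<open>big U V\<close> is \<open>V\<^sup>\<circ>\<close>.\<close>

definition big :: "(nat \<Rightarrow> 'u set) \<Rightarrow> nat set \<Rightarrow> nat set" where
  "big U V = {a \<in> V. card (U a) > 2}"

definition scheme_rel ::
  "nat \<Rightarrow> (nat \<Rightarrow> 'u set) \<Rightarrow> (nat \<Rightarrow> nat) \<Rightarrow> ((nat \<Rightarrow> 'u) \<times> (nat \<Rightarrow> 'u)) set" where
  "scheme_rel n U g =
    {(y, z) \<in> points n U \<times> points n U. \<forall>a\<in>{1..n}. y a \<noteq> z a \<longleftrightarrow> g a = 1}"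

definition valency :: "nat \<Rightarrow> (nat \<Rightarrow> 'u set) \<Rightarrow> (nat \<Rightarrow> nat) \<Rightarrow> nat" where
  "valency n U g = (\<Prod>a\<in>supp n g. card (U a) - 1)"

definition valid_triples ::
  "nat \<Rightarrow> (nat \<Rightarrow> 'u set) \<Rightarrow> ((nat \<Rightarrow> nat) \<times> (nat \<Rightarrow> nat) \<times> (nat \<Rightarrow> nat)) set" where
  "valid_triples n U =
    {(a, b, c) \<in> tuples01 n \<times> tuples01 n \<times> tuples01 n.
       sym_diff (supp n a) (supp n c) \<subseteq> supp n b \<and>
       supp n b \<subseteq> sym_diff (supp n a) (supp n c) \<union> big U (supp n a \<inter> supp n c)}"

text \<open>
  A matrix over \<open>'f\<close> with rows and columns indexed by the points is a function of two arguments
  that vanishes off the points.  Addition, zero and finite sums are the pointwise ones from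
  \<open>Function_Algebras\<close>; the product \<open>mat_times\<close> is the matrix product.
\<close>

type_synonym ('u, 'f) pmat = "(nat \<Rightarrow> 'u) \<Rightarrow> (nat \<Rightarrow> 'u) \<Rightarrow> 'f"

definition mat_carrier :: "nat \<Rightarrow> (nat \<Rightarrow> 'u set) \<Rightarrow> ('u, 'f::field) pmat set" where
  "mat_carrier n U = {M. \<forall>y z. \<not> (y \<in> points n U \<and> z \<in> points n U) \<longrightarrow> M y z = 0}"

definition mat_scale :: "'f::field \<Rightarrow> ('u, 'f) pmat \<Rightarrow> ('u, 'f) pmat" where
  "mat_scale c M = (\<lambda>y z. c * M y z)"

definition mat_times ::
  "nat \<Rightarrow> (nat \<Rightarrow> 'u set) \<Rightarrow> ('u, 'f::field) pmat \<Rightarrow> ('u, 'f) pmat \<Rightarrow> ('u, 'f) pmat" where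
  "mat_times n U M N = (\<lambda>y z. \<Sum>w\<in>points n U. M y w * N w z)"

definition mat_one :: "nat \<Rightarrow> (nat \<Rightarrow> 'u set) \<Rightarrow> ('u, 'f::field) pmat" where
  "mat_one n U = (\<lambda>y z. if y \<in> points n U \<and> y = z then 1 else 0)"

global_interpretation pmat: vector_space "mat_scale :: 'f::field \<Rightarrow> ('u, 'f) pmat \<Rightarrow> ('u, 'f) pmat"
  by unfold_locales (auto simp: mat_scale_def fun_eq_iff algebra_simps)

definition mat_subalgebra :: "nat \<Rightarrow> (nat \<Rightarrow> 'u set) \<Rightarrow> ('u, 'f::field) pmat set \<Rightarrow> bool" where
  "mat_subalgebra n U S \<longleftrightarrow>
     S \<subseteq> mat_carrier n U \<and> pmat.subspace S \<and> mat_one n U \<in> S \<and>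
     (\<forall>M\<in>S. \<forall>N\<in>S. mat_times n U M N \<in> S)"

definition adj_mat ::
  "nat \<Rightarrow> (nat \<Rightarrow> 'u set) \<Rightarrow> (nat \<Rightarrow> nat) \<Rightarrow> ('u, 'f::field) pmat" where
  "adj_mat n U g = (\<lambda>y z. if (y, z) \<in> scheme_rel n U g then 1 else 0)"

definition dual_idem ::
  "nat \<Rightarrow> (nat \<Rightarrow> 'u set) \<Rightarrow> (nat \<Rightarrow> 'u) \<Rightarrow> (nat \<Rightarrow> nat) \<Rightarrow> ('u, 'f::field) pmat" where
  "dual_idem n U x g = (\<lambda>y z. if y = z \<and> (x, y) \<in> scheme_rel n U g then 1 else 0)"

definition terwilliger_alg ::
  "nat \<Rightarrow> (nat \<Rightarrow> 'u set) \<Rightarrow> (nat \<Rightarrow> 'u) \<Rightarrow> ('u, 'f::field) pmat set" where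
  "terwilliger_alg n U x =
     mat_subalgebra n U hull (adj_mat n U ` tuples01 n \<union> dual_idem n U x ` tuples01 n)"

definition mat_center ::
  "nat \<Rightarrow> (nat \<Rightarrow> 'u set) \<Rightarrow> ('u, 'f::field) pmat set \<Rightarrow> ('u, 'f) pmat set" where
  "mat_center n U S = {M \<in> S. \<forall>N\<in>S. mat_times n U M N = mat_times n U N M}"

definition B_mat ::
  "nat \<Rightarrow> (nat \<Rightarrow> 'u set) \<Rightarrow> (nat \<Rightarrow> 'u) \<Rightarrow>
   (nat \<Rightarrow> nat) \<Rightarrow> (nat \<Rightarrow> nat) \<Rightarrow> (nat \<Rightarrow> nat) \<Rightarrow> ('u, 'f::field) pmat" where
  "B_mat n U x g h i =
     (\<Sum>j\<in>{j \<in> tuples01 n. sym_diff (supp n g) (supp n i) \<subseteq> supp n j \<and> supp n j \<subseteq> supp n h}.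
        mat_times n U (mat_times n U (dual_idem n U x g) (adj_mat n U j)) (dual_idem n U x i))"

definition C_mat ::
  "nat \<Rightarrow> (nat \<Rightarrow> 'u set) \<Rightarrow> (nat \<Rightarrow> 'u) \<Rightarrow> (nat \<Rightarrow> nat) \<Rightarrow> ('u, 'f::field) pmat" where
  "C_mat n U x g =
     (\<Sum>h\<in>tuples01 n.
        mat_scale (of_nat (valency n U (diff01 n g h))) (B_mat n U x h (meet01 n g h) h))"

text \<open>The hull in \<open>terwilliger_alg\<close> is taken over a nonempty family:\<close>

lemma mat_subalgebra_carrier:
  "mat_subalgebra n U (mat_carrier n U)"
  by (auto simp: mat_subalgebra_def mat_carrier_def pmat.subspace_def mat_scale_def
      mat_times_def mat_one_def)

lemma generators_in_carrier:
  "adj_mat n U ` tuples01 n \<union> dual_idem n U x ` tuples01 n \<subseteq> mat_carrier n U"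
  by (auto simp: mat_carrier_def adj_mat_def dual_idem_def scheme_rel_def)

end

theory Submission
  imports Defs "HOL-Combinatorics.Transposition"
begin

text \<open>
  The matrix \<open>C\<^sub>G\<close> is the tensor product over the coordinates of \<open>k E\<^sup>*\<^sub>0 + J\<close> (for \<open>a \<in> G\<close>, with
  \<open>k = |U\<^sub>a| - 1\<close> and \<open>J\<close> the all-one matrix on \<open>U\<^sub>a - {x\<^sub>a}\<close>) and the identity (for \<open>a \<notin> G\<close>).  All
  row and column sums of \<open>k E\<^sup>*\<^sub>0 + J\<close> equal \<open>k\<close>, hence \<open>C\<^sub>G\<close> is central.  Conversely, a central \<open>M\<close>
  commutes with the \<open>E\<^sup>*\<^sub>h\<close> and is thus block diagonal, and commuting with \<open>E\<^sup>*\<^sub>1 A E\<^sup>*\<^sub>h\<close> shows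
  that it is determined by its block at the all-one tuple.  There the entry of \<open>M\<close> at \<open>(y, z)\<close> depends only on the
  set \<open>J\<close> of coordinates in which \<open>y\<close> and \<open>z\<close> differ, because the algebra is fixed by the
  coordinatewise permutations that fix \<open>x\<close>; this set contains only coordinates with \<open>|U\<^sub>a| > 2\<close>.
  The entry of \<open>C\<^sub>G\<close> is \<open>1\<close> if \<open>J \<subseteq> G\<close> and \<open>0\<close> otherwise, so Moebius inversion on the subset
  lattice gives existence and uniqueness of the coefficients.
\<close>

text \<open>Otherwise the simplifier turns \<open>{1..n}\<close> into \<open>{Suc 0..n}\<close>.\<close>

declare One_nat_def [simp del]

section \<open>Moebius inversion on the subset lattice\<close>

text \<open>Induction on \<open>B\<close>. Supersets of \<open>J\<close> inside
  \<open>insert b B\<close> either contain \<open>b\<close> or lie in \<open>B\<close>. Those with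
  \<open>b\<close> must sum to \<open>f (insert b J)\<close>, so those without \<open>b\<close> must
  sum to the difference \<open>f J - f (insert b J)\<close>. The induction hypothesis is applied to
  both functions.\<close>

lemma superset_sum_inversion:
  fixes f :: "'b set \<Rightarrow> 'a::ab_group_add"
  assumes "finite B"
  shows "\<exists>c. \<forall>J\<subseteq>B. f J = (\<Sum>G | J \<subseteq> G \<and> G \<subseteq> B. c G)"
  using assms
proof (induction B arbitrary: f)
  case empty
  have "{G. {} \<subseteq> G \<and> G \<subseteq> {}} = {{} :: 'b set}" by auto
  then show ?case by (intro exI[of _ f]) auto
next
  case (insert b B)
  from insert.IH[of "\<lambda>J. f J - f (insert b J)"] obtain c0 where
    c0: "\<And>J. J \<subseteq> B \<Longrightarrow> f J - f (insert b J) = (\<Sum>G | J \<subseteq> G \<and> G \<subseteq> B. c0 G)"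
    by blast
  from insert.IH[of "\<lambda>J. f (insert b J)"] obtain c1 where
    c1: "\<And>J. J \<subseteq> B \<Longrightarrow> f (insert b J) = (\<Sum>G | J \<subseteq> G \<and> G \<subseteq> B. c1 G)"
    by blast
  define c where "c G = (if b \<in> G then c1 (G - {b}) else c0 G)" for G
  have with_b: "(\<Sum>G | insert b J \<subseteq> G \<and> G \<subseteq> insert b B. c G) = f (insert b J)"
    if "J \<subseteq> B" for J
  proof -
    have "(\<Sum>G | J \<subseteq> G \<and> G \<subseteq> B. c1 G) = (\<Sum>G | insert b J \<subseteq> G \<and> G \<subseteq> insert b B. c G)"
      using \<open>b \<notin> B\<close> that
      by (intro sum.reindex_bij_witness[where i = "\<lambda>G. G - {b}" and j = "insert b"])
        (auto simp: c_def insert_absorb subset_iff intro!: arg_cong[of _ _ c1])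
    then show ?thesis using c1[OF that] by simp
  qed
  show ?case
  proof (intro exI allI impI)
    fix J assume J: "J \<subseteq> insert b B"
    show "f J = (\<Sum>G | J \<subseteq> G \<and> G \<subseteq> insert b B. c G)"
    proof (cases "b \<in> J")
      case True
      then show ?thesis using with_b[of "J - {b}"] J
        by (simp add: insert_absorb Diff_subset_conv)
    next
      case False
      then have JB: "J \<subseteq> B" using J by auto
      have split: "{G. J \<subseteq> G \<and> G \<subseteq> insert b B} =
          {G. insert b J \<subseteq> G \<and> G \<subseteq> insert b B} \<union> {G. J \<subseteq> G \<and> G \<subseteq> B}"
        by auto
      have "(\<Sum>G | J \<subseteq> G \<and> G \<subseteq> insert b B. c G) =
          (\<Sum>G | insert b J \<subseteq> G \<and> G \<subseteq> insert b B. c G) + (\<Sum>G | J \<subseteq> G \<and> G \<subseteq> B. c G)"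
        unfolding split using insert.hyps by (intro sum.union_disjoint) auto
      moreover have "(\<Sum>G | J \<subseteq> G \<and> G \<subseteq> B. c G) = (\<Sum>G | J \<subseteq> G \<and> G \<subseteq> B. c0 G)"
        using insert.hyps by (intro sum.cong) (auto simp: c_def)
      ultimately show ?thesis using with_b[OF JB] c0[OF JB] by (metis diff_add_cancel add.commute)
    qed
  qed
qed

text \<open>Triangularity: descending from \<open>J = B\<close>, the coefficients of all proper
  supersets of \<open>J\<close> are already zero, so the sum for \<open>J\<close> consists of
  \<open>c J\<close> alone.\<close>

lemma superset_sums_zero_imp_zero:
  fixes c :: "'b set \<Rightarrow> 'a::ab_group_add"
  assumes "finite B" and zero: "\<And>J. J \<subseteq> B \<Longrightarrow> (\<Sum>G | J \<subseteq> G \<and> G \<subseteq> B. c G) = 0"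
    and "J \<subseteq> B"
  shows "c J = 0"
  using \<open>J \<subseteq> B\<close>
proof (induction "card (B - J)" arbitrary: J rule: less_induct)
  case less
  have "c G = 0" if "J \<subset> G" "G \<subseteq> B" for G
  proof (rule less.hyps)
    show "card (B - G) < card (B - J)"
      using that \<open>finite B\<close> by (intro psubset_card_mono) auto
  qed (use that in auto)
  moreover have "{G. J \<subseteq> G \<and> G \<subseteq> B} = insert J {G. J \<subset> G \<and> G \<subseteq> B}"
    using less.prems by auto
  moreover have "finite {G. J \<subset> G \<and> G \<subseteq> B}"
    using \<open>finite B\<close> by simp
  ultimately show ?case using zero[OF less.prems] by simp
qed

section \<open>Difference sets and tuples as subsets\<close>

lemma sum_fun_apply2: "(\<Sum>i\<in>I. F i) y z = (\<Sum>i\<in>I. F i y z)"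
  by (induction I rule: infinite_finite_induct) auto

text \<open>This set names the relation of the scheme that contains \<open>(y, z)\<close>. With the
  base point as first argument it names the block of a point, called \<open>support\<close>
  below.\<close>

definition diff_set :: "nat \<Rightarrow> (nat \<Rightarrow> 'u) \<Rightarrow> (nat \<Rightarrow> 'u) \<Rightarrow> nat set" where
  "diff_set n y z = {a \<in> {1..n}. y a \<noteq> z a}"

lemma diff_set_subset: "diff_set n y z \<subseteq> {1..n}"
  by (auto simp: diff_set_def)

lemma mem_diff_set_iff: "a \<in> {1..n} \<Longrightarrow> a \<in> diff_set n y z \<longleftrightarrow> y a \<noteq> z a"
  by (simp add: diff_set_def)

lemma diff_set_eqD:
  "diff_set n y z = diff_set n y' z' \<Longrightarrow> a \<in> {1..n} \<Longrightarrow> y a = z a \<longleftrightarrow> y' a = z' a"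
  by (metis mem_diff_set_iff)

lemma diff_set_eqI:
  assumes "V \<subseteq> {1..n}" and "\<And>a. a \<in> {1..n} \<Longrightarrow> y a \<noteq> z a \<longleftrightarrow> a \<in> V"
  shows "diff_set n y z = V"
  using assms unfolding diff_set_def by blast

lemma diff_set_fullD: "diff_set n y z = {1..n} \<Longrightarrow> a \<in> {1..n} \<Longrightarrow> y a \<noteq> z a"
  by (metis mem_diff_set_iff)

lemma scheme_rel_tuple_of:
  assumes "V \<subseteq> {1..n}"
  shows "(y, z) \<in> scheme_rel n U (tuple_of n V) \<longleftrightarrow>
    y \<in> points n U \<and> z \<in> points n U \<and> diff_set n y z = V"
  using assms by (auto simp: scheme_rel_def tuple_of_def diff_set_def split: if_splits)

lemma tuples01_eq: "tuples01 n = tuple_of n ` Pow {1..n}"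
proof (intro equalityI subsetI)
  fix g assume "g \<in> tuples01 n"
  moreover have "supp n g \<in> Pow {1..n}" by (auto simp: supp_def)
  ultimately show "g \<in> tuple_of n ` Pow {1..n}" by (metis imageI tuple_of_supp)
qed (auto simp: tuple_of_in_tuples01)

lemma inj_on_tuple_of: "inj_on (tuple_of n) (Pow {1..n})"
  by (rule inj_on_inverseI[where g = "supp n"]) (simp add: supp_tuple_of)

locale pointed_factorial_scheme =
  fixes n :: nat and U :: "nat \<Rightarrow> 'u set" and x :: "nat \<Rightarrow> 'u"
  assumes fin: "a \<in> {1..n} \<Longrightarrow> finite (U a)"
    and card_ge_2: "a \<in> {1..n} \<Longrightarrow> card (U a) \<ge> 2"
    and base: "x \<in> points n U"
begin

abbreviation "X \<equiv> points n U"
abbreviation "support \<equiv> diff_set n x"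
abbreviation times (infixl "\<odot>" 70) where "M \<odot> N \<equiv> mat_times n U M N"
abbreviation "T \<equiv> terwilliger_alg n U x"
abbreviation "large \<equiv> big U {1..n}"

lemma finite_X: "finite X"
  unfolding points_def by (intro finite_PiE) (use fin in auto)

lemma X_mem: "y \<in> X \<Longrightarrow> a \<in> {1..n} \<Longrightarrow> y a \<in> U a"
  by (auto simp: points_def)

lemma X_eqI: "y \<in> X \<Longrightarrow> z \<in> X \<Longrightarrow> (\<And>a. a \<in> {1..n} \<Longrightarrow> y a = z a) \<Longrightarrow> y = z"
  unfolding points_def by (rule PiE_ext)

section \<open>Entries of the matrices\<close>

lemma adj_mat_tuple_of:
  "V \<subseteq> {1..n} \<Longrightarrow> adj_mat n U (tuple_of n V) y z =
    (if y \<in> X \<and> z \<in> X \<and> diff_set n y z = V then 1 else 0)"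
  by (simp add: adj_mat_def scheme_rel_tuple_of)

lemma dual_idem_tuple_of:
  "V \<subseteq> {1..n} \<Longrightarrow> dual_idem n U x (tuple_of n V) y z =
    (if y = z \<and> y \<in> X \<and> support y = V then 1 else 0)"
  using base by (simp add: dual_idem_def scheme_rel_tuple_of)

lemma dual_idem_times:
  assumes "V \<subseteq> {1..n}"
  shows "(dual_idem n U x (tuple_of n V) \<odot> M) y z =
    (if y \<in> X \<and> support y = V then M y z else 0)"
proof -
  have "(dual_idem n U x (tuple_of n V) \<odot> M) y z =
      (\<Sum>w\<in>X. if w = y then (if support y = V then M y z else 0) else 0)"
    unfolding mat_times_def by (intro sum.cong) (auto simp: dual_idem_tuple_of[OF assms])
  also have "\<dots> = (if y \<in> X \<and> support y = V then M y z else 0)"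
    using finite_X by simp
  finally show ?thesis .
qed

lemma times_dual_idem:
  assumes "V \<subseteq> {1..n}"
  shows "(M \<odot> dual_idem n U x (tuple_of n V)) y z =
    (if z \<in> X \<and> support z = V then M y z else 0)"
proof -
  have "(M \<odot> dual_idem n U x (tuple_of n V)) y z =
      (\<Sum>w\<in>X. if w = z then (if support z = V then M y z else 0) else 0)"
    unfolding mat_times_def by (intro sum.cong) (auto simp: dual_idem_tuple_of[OF assms])
  also have "\<dots> = (if z \<in> X \<and> support z = V then M y z else 0)"
    using finite_X by simp
  finally show ?thesis .
qed

lemma block_entry:
  assumes "V \<subseteq> {1..n}" "J \<subseteq> {1..n}" "W \<subseteq> {1..n}"
  shows "(dual_idem n U x (tuple_of n V) \<odot> adj_mat n U (tuple_of n J)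
      \<odot> dual_idem n U x (tuple_of n W)) y z =
    (if y \<in> X \<and> z \<in> X \<and> support y = V \<and> support z = W \<and> diff_set n y z = J then 1 else 0)"
  using assms by (simp add: times_dual_idem dual_idem_times adj_mat_tuple_of)

text \<open>With equal outer indices the lower bound on \<open>supp n j\<close> is empty, so the sum
  runs over all subsets \<open>J\<close> of \<open>K\<close>. At a given pair only
  \<open>J = diff_set n y z\<close> can contribute.\<close>

lemma B_mat_entry:
  assumes "H \<subseteq> {1..n}" "K \<subseteq> {1..n}"
  shows "B_mat n U x (tuple_of n H) (tuple_of n K) (tuple_of n H) y z =
    (if y \<in> X \<and> z \<in> X \<and> support y = H \<and> support z = H \<and> diff_set n y z \<subseteq> K then 1 else 0)"
proof -
  have "{j \<in> tuples01 n. sym_diff (supp n (tuple_of n H)) (supp n (tuple_of n H)) \<subseteq> supp n j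
      \<and> supp n j \<subseteq> supp n (tuple_of n K)} = tuple_of n ` Pow K"
    using assms(2) by (auto simp: tuples01_eq supp_tuple_of image_iff)
  moreover have "inj_on (tuple_of n) (Pow K)"
    using inj_on_tuple_of by (rule inj_on_subset) (use assms in auto)
  ultimately have "B_mat n U x (tuple_of n H) (tuple_of n K) (tuple_of n H) y z =
      (\<Sum>J\<in>Pow K. (dual_idem n U x (tuple_of n H) \<odot> adj_mat n U (tuple_of n J)
      \<odot> dual_idem n U x (tuple_of n H)) y z)"
    by (simp add: B_mat_def sum_fun_apply2 sum.reindex)
  also have "\<dots> = (\<Sum>J\<in>Pow K. if J = diff_set n y z
      then (if y \<in> X \<and> z \<in> X \<and> support y = H \<and> support z = H then 1 else 0) else 0)"
    using assms by (intro sum.cong) (auto simp: block_entry)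
  also have "\<dots> = (if y \<in> X \<and> z \<in> X \<and> support y = H \<and> support z = H \<and> diff_set n y z \<subseteq> K
      then 1 else 0)"
    using finite_subset[OF assms(2)] by simp
  finally show ?thesis .
qed

text \<open>Only the summand with \<open>H = support y\<close> can be nonzero at
  \<open>(y, z)\<close>, and it contributes the valency of \<open>G - H\<close>.\<close>

lemma C_mat_entry:
  assumes G: "G \<subseteq> {1..n}"
  shows "C_mat n U x (tuple_of n G) y z =
    (if y \<in> X \<and> z \<in> X \<and> support y = support z \<and> diff_set n y z \<subseteq> G
     then of_nat (\<Prod>a\<in>G - support y. card (U a) - 1) else 0)"
proof -
  \<comment> \<open>Points that both agree with \<open>x\<close> in a coordinate agree with each
    other there. Hence being contained in \<open>G \<inter> H\<close> reduces to being contained in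
    \<open>G\<close>.\<close>
  have diff_le: "diff_set n y z \<subseteq> support y" if "support y = support z"
  proof
    fix a assume "a \<in> diff_set n y z"
    then have "a \<in> {1..n}" "y a \<noteq> z a" by (simp_all add: diff_set_def)
    with diff_set_eqD[OF that] show "a \<in> support y" by (metis mem_diff_set_iff)
  qed
  have "C_mat n U x (tuple_of n G) y z = (\<Sum>H\<in>Pow {1..n}.
      of_nat (valency n U (diff01 n (tuple_of n G) (tuple_of n H)))
      * B_mat n U x (tuple_of n H) (meet01 n (tuple_of n G) (tuple_of n H)) (tuple_of n H) y z)"
    by (simp add: C_mat_def tuples01_eq sum.reindex inj_on_tuple_of sum_fun_apply2 mat_scale_def)
  also have "\<dots> = (\<Sum>H\<in>Pow {1..n}. if H = support y then
      (if y \<in> X \<and> z \<in> X \<and> support y = support z \<and> diff_set n y z \<subseteq> G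
     then of_nat (\<Prod>a\<in>G - support y. card (U a) - 1) else 0) else 0)"
  proof (intro sum.cong refl)
    fix H assume "H \<in> Pow {1..n}"
    then have H: "H \<subseteq> {1..n}" "G \<inter> H \<subseteq> {1..n}" "G - H \<subseteq> {1..n}" using G by auto
    then show "of_nat (valency n U (diff01 n (tuple_of n G) (tuple_of n H)))
        * B_mat n U x (tuple_of n H) (meet01 n (tuple_of n G) (tuple_of n H)) (tuple_of n H) y z
      = (if H = support y then
      (if y \<in> X \<and> z \<in> X \<and> support y = support z \<and> diff_set n y z \<subseteq> G
     then of_nat (\<Prod>a\<in>G - support y. card (U a) - 1) else 0) else 0)"
      using diff_le
      by (auto simp: valency_def diff01_def meet01_def supp_tuple_of G B_mat_entry)
  qed
  also have "\<dots> = (if y \<in> X \<and> z \<in> X \<and> support y = support z \<and> diff_set n y z \<subseteq> G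
     then of_nat (\<Prod>a\<in>G - support y. card (U a) - 1) else 0)"
    using diff_set_subset[of n x y] by simp
  finally show ?thesis .
qed

section \<open>Tensor factorization and centrality\<close>

text \<open>\<open>C\<^sub>G\<close> is the tensor product of these local factors; each of them is central in the
  Terwilliger algebra of the trivial scheme on \<open>U a\<close>.\<close>

definition local_factor :: "nat set \<Rightarrow> nat \<Rightarrow> 'u \<Rightarrow> 'u \<Rightarrow> 'f::field" where
  "local_factor G a s t = (if a \<in> G
     then if s = x a \<and> t = x a then of_nat (card (U a) - 1)
       else if s \<noteq> x a \<and> t \<noteq> x a then 1 else 0
     else if s = t then 1 else 0)"

text \<open>For equal supports and differences inside \<open>G\<close>, each factor is 1 except at
  coordinates in \<open>G - support y\<close>, which supply the valency. In every other case some
  factor vanishes.\<close>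

lemma C_mat_eq_prod:
  assumes G: "G \<subseteq> {1..n}" and yz: "y \<in> X" "z \<in> X"
  shows "C_mat n U x (tuple_of n G) y z = (\<Prod>a\<in>{1..n}. local_factor G a (y a) (z a) :: 'f::field)"
proof (cases "support y = support z \<and> diff_set n y z \<subseteq> G")
  case True
  have "(\<Prod>a\<in>{1..n}. local_factor G a (y a) (z a) :: 'f)
      = (\<Prod>a\<in>{1..n}. if a \<in> G - support y then of_nat (card (U a) - 1) else 1)"
  proof (intro prod.cong refl)
    fix a assume a: "a \<in> {1..n}"
    have 1: "x a = y a \<longleftrightarrow> x a = z a"
      using conjunct1[OF True] a by (rule diff_set_eqD)
    have 2: "y a \<noteq> z a \<longrightarrow> a \<in> G"
      using conjunct2[OF True] mem_diff_set_iff[OF a] by blast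
    show "(local_factor G a (y a) (z a) :: 'f)
        = (if a \<in> G - support y then of_nat (card (U a) - 1) else 1)"
    proof (cases "x a = y a")
      case True
      then have "y a = x a" "z a = x a" using 1 by auto
      then show ?thesis by (simp add: local_factor_def mem_diff_set_iff[OF a])
    next
      case False
      then have "y a \<noteq> x a" "z a \<noteq> x a" using 1 by auto
      then show ?thesis using 2 by (auto simp: local_factor_def mem_diff_set_iff[OF a])
    qed
  qed
  also have "\<dots> = (\<Prod>a\<in>G - support y. of_nat (card (U a) - 1))"
    using G by (intro prod.mono_neutral_cong_right) auto
  finally show ?thesis using True yz G by (simp add: C_mat_entry)
next
  case False
  have "\<exists>a\<in>{1..n}. (x a = y a) \<noteq> (x a = z a) \<or> y a \<noteq> z a \<and> a \<notin> G"
  proof (rule ccontr)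
    assume "\<not> ?thesis"
    then have all: "x a = y a \<longleftrightarrow> x a = z a" "y a \<noteq> z a \<Longrightarrow> a \<in> G" if "a \<in> {1..n}" for a
      using that by blast+
    have "support y = support z"
      by (rule diff_set_eqI) (simp_all add: diff_set_subset mem_diff_set_iff all(1))
    moreover have "diff_set n y z \<subseteq> G"
      using all(2) unfolding diff_set_def by blast
    ultimately show False using False by simp
  qed
  then obtain a where a: "a \<in> {1..n}"
    and "(x a = y a) \<noteq> (x a = z a) \<or> y a \<noteq> z a \<and> a \<notin> G"
    by blast
  then consider "y a = x a" "z a \<noteq> x a" | "y a \<noteq> x a" "z a = x a" | "y a \<noteq> z a" "a \<notin> G"
    by metis
  then have "(local_factor G a (y a) (z a) :: 'f) = 0"
    by cases (auto simp: local_factor_def)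
  then have "(\<Prod>a\<in>{1..n}. local_factor G a (y a) (z a) :: 'f) = 0"
    using a by (intro prod_zero) auto
  then show ?thesis using False yz G by (auto simp: C_mat_entry)
qed

text \<open>Row \<open>x a\<close> has the single nonzero candidate \<open>card (U a) - 1\<close>;
  every other row has 0 at \<open>x a\<close> and 1 at the remaining \<open>card (U a) - 1\<close>
  points.\<close>

lemma sum_local_factor:
  assumes a: "a \<in> {1..n}" "a \<in> G" and s: "s \<in> U a"
  shows "(\<Sum>w\<in>U a. local_factor G a s w) = (of_nat (card (U a) - 1) :: 'f::field)"
proof -
  have xa: "x a \<in> U a" using base a(1) by (rule X_mem)
  have "(\<Sum>w\<in>U a. local_factor G a s w) =
      local_factor G a s (x a) + (\<Sum>w\<in>U a - {x a}. local_factor G a s w :: 'f)"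
    using xa fin[OF a(1)] by (simp add: sum.remove)
  also have "(\<Sum>w\<in>U a - {x a}. local_factor G a s w :: 'f) =
      (\<Sum>w\<in>U a - {x a}. if s = x a then 0 else 1)"
    using a by (intro sum.cong) (auto simp: local_factor_def)
  finally show ?thesis
    using a xa fin[OF a(1)] by (auto simp: local_factor_def)
qed

lemma local_factor_sym: "local_factor G a s t = local_factor G a t s"
  by (auto simp: local_factor_def)

text \<open>The indicator is the identity matrix if \<open>P\<close> is false and all-one minus
  identity if \<open>P\<close> is true. Commuting with the all-one matrix amounts to equality of row
  sums and column sums.\<close>

lemma local_factor_commute:
  assumes a: "a \<in> {1..n}" and st: "s \<in> U a" "t \<in> U a"
  shows "(\<Sum>w\<in>U a. local_factor G a s w * (if (w \<noteq> t) = P then 1 else 0)) =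
    (\<Sum>w\<in>U a. (if (s \<noteq> w) = P then 1 else 0) * local_factor G a w t :: 'f::field)"
proof -
  note [simp] = fin[OF a]
  have eq1: "(\<Sum>w\<in>U a. local_factor G a s w * (if w = t then 1 else 0)) = (local_factor G a s t :: 'f)"
    using st by (simp add: if_distrib cong: if_cong)
  have eq2: "(\<Sum>w\<in>U a. (if s = w then 1 else 0) * local_factor G a w t) = (local_factor G a s t :: 'f)"
    using st by (simp add: if_distrib[of "\<lambda>u. u * _"] cong: if_cong)
  show ?thesis
  proof (cases P)
    case False
    then show ?thesis using eq1 eq2 by simp
  next
    case True
    have sums: "(\<Sum>w\<in>U a. local_factor G a s w) = (\<Sum>w\<in>U a. local_factor G a w t :: 'f)"
    proof (cases "a \<in> G")
      case True
      then show ?thesis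
        using sum_local_factor[OF a True st(1), where ?'f = 'f]
          sum_local_factor[OF a True st(2), where ?'f = 'f]
        by (simp only: local_factor_sym[of G a _ t])
    next
      case False
      then show ?thesis using st by (simp add: local_factor_def)
    qed
    have "(\<Sum>w\<in>U a. local_factor G a s w * (if w \<noteq> t then 1 else 0)) =
        (\<Sum>w\<in>U a. local_factor G a s w - local_factor G a s w * (if w = t then 1 else 0) :: 'f)"
      by (intro sum.cong) auto
    also have "\<dots> = (\<Sum>w\<in>U a. local_factor G a w t - (if s = w then 1 else 0) * local_factor G a w t)"
      unfolding sum_subtractf using sums eq1 eq2 by simp
    also have "\<dots> = (\<Sum>w\<in>U a. (if s \<noteq> w then 1 else 0) * local_factor G a w t)"
      by (intro sum.cong) auto
    finally show ?thesis using True by simp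
  qed
qed

lemma adj_mat_eq_prod:
  assumes "V \<subseteq> {1..n}" "y \<in> X" "z \<in> X"
  shows "adj_mat n U (tuple_of n V) y z =
    (\<Prod>a\<in>{1..n}. if (y a \<noteq> z a) = (a \<in> V) then 1 else 0 :: 'f::field)"
proof (cases "diff_set n y z = V")
  case True
  then have "\<forall>a\<in>{1..n}. (y a \<noteq> z a) = (a \<in> V)" by (auto simp: diff_set_def)
  then show ?thesis using True assms by (simp add: adj_mat_tuple_of)
next
  case False
  then obtain a where "a \<in> {1..n}" "(y a \<noteq> z a) \<noteq> (a \<in> V)"
    using assms(1) unfolding diff_set_def by blast
  then have "(\<Prod>a\<in>{1..n}. if (y a \<noteq> z a) = (a \<in> V) then 1 else 0 :: 'f) = 0"
    by (intro prod_zero) auto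
  then show ?thesis using False assms by (simp add: adj_mat_tuple_of)
qed

text \<open>Both matrices are tensor products, so distributivity turns each entry of their product
  into a product of sums over single coordinates, where the local factors commute.\<close>

lemma C_mat_commutes_adj_mat:
  assumes G: "G \<subseteq> {1..n}" and V: "V \<subseteq> {1..n}"
  shows "C_mat n U x (tuple_of n G) \<odot> adj_mat n U (tuple_of n V) =
    adj_mat n U (tuple_of n V) \<odot> (C_mat n U x (tuple_of n G) :: ('u, 'f::field) pmat)"
proof (intro ext)
  fix y z
  let ?C = "C_mat n U x (tuple_of n G) :: ('u, 'f) pmat"
  let ?A = "adj_mat n U (tuple_of n V) :: ('u, 'f) pmat"
  let ?ind = "\<lambda>a s t. if (s \<noteq> t) = (a \<in> V) then 1 else 0 :: 'f"
  show "(?C \<odot> ?A) y z = (?A \<odot> ?C) y z"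
  proof (cases "y \<in> X \<and> z \<in> X")
    case False
    then show ?thesis
      by (auto simp: mat_times_def C_mat_entry[OF G] adj_mat_tuple_of[OF V])
  next
    case True
    have "(?C \<odot> ?A) y z = (\<Sum>w\<in>X. \<Prod>a\<in>{1..n}. local_factor G a (y a) (w a) * ?ind a (w a) (z a))"
      unfolding mat_times_def using True
      by (intro sum.cong refl) (simp only: C_mat_eq_prod[OF G] adj_mat_eq_prod[OF V] prod.distrib)
    also have "\<dots> = (\<Prod>a\<in>{1..n}. \<Sum>w\<in>U a. local_factor G a (y a) w * ?ind a w (z a))"
      unfolding points_def using fin by (subst prod_sum_PiE) auto
    also have "\<dots> = (\<Prod>a\<in>{1..n}. \<Sum>w\<in>U a. ?ind a (y a) w * local_factor G a w (z a))"
      using True X_mem by (intro prod.cong refl local_factor_commute) auto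
    also have "\<dots> = (\<Sum>w\<in>X. \<Prod>a\<in>{1..n}. ?ind a (y a) (w a) * local_factor G a (w a) (z a))"
      unfolding points_def using fin by (subst prod_sum_PiE) auto
    also have "\<dots> = (?A \<odot> ?C) y z"
      unfolding mat_times_def using True
      by (intro sum.cong refl) (simp only: C_mat_eq_prod[OF G] adj_mat_eq_prod[OF V] prod.distrib)
    finally show ?thesis .
  qed
qed

lemma C_mat_commutes_dual_idem:
  assumes G: "G \<subseteq> {1..n}" and V: "V \<subseteq> {1..n}"
  shows "C_mat n U x (tuple_of n G) \<odot> dual_idem n U x (tuple_of n V) =
    dual_idem n U x (tuple_of n V) \<odot> (C_mat n U x (tuple_of n G) :: ('u, 'f::field) pmat)"
  by (intro ext) (auto simp: times_dual_idem[OF V] dual_idem_times[OF V] C_mat_entry[OF G])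

section \<open>Matrix algebra, the Terwilliger algebra and its center\<close>

lemma mat_times_assoc: "(L \<odot> M) \<odot> N = L \<odot> (M \<odot> N)"
proof (intro ext)
  fix y z
  have "((L \<odot> M) \<odot> N) y z = (\<Sum>v\<in>X. \<Sum>w\<in>X. L y w * M w v * N v z)"
    by (simp add: mat_times_def sum_distrib_right)
  also have "\<dots> = (\<Sum>w\<in>X. \<Sum>v\<in>X. L y w * M w v * N v z)"
    by (rule sum.swap)
  also have "\<dots> = (L \<odot> (M \<odot> N)) y z"
    by (simp add: mat_times_def sum_distrib_left mult.assoc)
  finally show "((L \<odot> M) \<odot> N) y z = (L \<odot> (M \<odot> N)) y z" .
qed

lemma mat_times_add: "(L + M) \<odot> N = L \<odot> N + M \<odot> N" "N \<odot> (L + M) = N \<odot> L + N \<odot> M"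
  by (auto simp: mat_times_def fun_eq_iff algebra_simps sum.distrib)

lemma mat_times_scale:
  "mat_scale c M \<odot> N = mat_scale c (M \<odot> N)" "N \<odot> mat_scale c M = mat_scale c (N \<odot> M)"
  by (auto simp: mat_times_def mat_scale_def fun_eq_iff sum_distrib_left mult_ac)

lemma mat_times_zero: "0 \<odot> N = 0" "N \<odot> 0 = 0"
  by (auto simp: mat_times_def fun_eq_iff)

lemma mat_times_one:
  assumes "M \<in> mat_carrier n U"
  shows "M \<odot> mat_one n U = M" "mat_one n U \<odot> M = M"
proof -
  have "(M \<odot> mat_one n U) y z = M y z" for y z
  proof -
    have "(M \<odot> mat_one n U) y z = (\<Sum>w\<in>X. if w = z then M y z else 0)"
      unfolding mat_times_def mat_one_def by (intro sum.cong) auto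
    then show ?thesis using assms finite_X by (auto simp: mat_carrier_def)
  qed
  moreover have "(mat_one n U \<odot> M) y z = M y z" for y z
  proof -
    have "(mat_one n U \<odot> M) y z = (\<Sum>w\<in>X. if w = y then M y z else 0)"
      unfolding mat_times_def mat_one_def by (intro sum.cong) auto
    then show ?thesis using assms finite_X by (auto simp: mat_carrier_def)
  qed
  ultimately show "M \<odot> mat_one n U = M" "mat_one n U \<odot> M = M" by (simp_all add: fun_eq_iff)
qed

lemma times_in_carrier:
  "M \<in> mat_carrier n U \<Longrightarrow> N \<in> mat_carrier n U \<Longrightarrow> M \<odot> N \<in> mat_carrier n U"
  using mat_subalgebra_carrier unfolding mat_subalgebra_def by blast

text \<open>This reduces centrality in \<open>T\<close> to commuting with the generators.\<close>

lemma mat_subalgebra_centralizer: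
  fixes M :: "('u, 'f::field) pmat"
  assumes "M \<in> mat_carrier n U"
  shows "mat_subalgebra n U {N \<in> mat_carrier n U. M \<odot> N = N \<odot> M}"
  unfolding mat_subalgebra_def pmat.subspace_def
proof (intro conjI ballI allI)
  show "mat_one n U \<in> {N \<in> mat_carrier n U. M \<odot> N = N \<odot> M}"
    using assms by (simp add: mat_times_one) (simp add: mat_one_def mat_carrier_def)
  fix P Q assume "P \<in> {N \<in> mat_carrier n U. M \<odot> N = N \<odot> M}"
    and "Q \<in> {N \<in> mat_carrier n U. M \<odot> N = N \<odot> M}"
  moreover from this have "M \<odot> (P \<odot> Q) = (P \<odot> Q) \<odot> M"
    by (metis (mono_tags, lifting) mat_times_assoc mem_Collect_eq)
  ultimately show "P \<odot> Q \<in> {N \<in> mat_carrier n U. M \<odot> N = N \<odot> M}"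
    by (simp add: times_in_carrier)
qed (use mat_subalgebra_carrier[of n U, where ?'b = 'f] in
  \<open>auto simp: mat_subalgebra_def pmat.subspace_def mat_times_add mat_times_scale mat_times_zero\<close>)

lemma mat_subalgebra_Inter:
  assumes "\<And>S. S \<in> \<S> \<Longrightarrow> mat_subalgebra n U S" and "\<S> \<noteq> {}"
  shows "mat_subalgebra n U (\<Inter>\<S>)"
  using assms unfolding mat_subalgebra_def pmat.subspace_def by blast

lemma mat_subalgebra_T: "mat_subalgebra n U (T :: ('u, 'f::field) pmat set)"
  unfolding terwilliger_alg_def hull_def
proof (rule mat_subalgebra_Inter)
  show "{t. mat_subalgebra n U t \<and>
      adj_mat n U ` tuples01 n \<union> dual_idem n U x ` tuples01 n \<subseteq> t} \<noteq> ({} :: ('u, 'f) pmat set set)"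
    using mat_subalgebra_carrier generators_in_carrier by blast
qed simp

lemma T_carrier: "T \<subseteq> mat_carrier n U"
  and T_subspace: "pmat.subspace T"
  and T_times: "M \<in> T \<Longrightarrow> N \<in> T \<Longrightarrow> M \<odot> N \<in> T"
  using mat_subalgebra_T unfolding mat_subalgebra_def by auto

lemma adj_mat_in_T: "g \<in> tuples01 n \<Longrightarrow> adj_mat n U g \<in> T"
  and dual_idem_in_T: "g \<in> tuples01 n \<Longrightarrow> dual_idem n U x g \<in> T"
  unfolding terwilliger_alg_def by (auto intro!: hull_inc)

lemma T_subsetI:
  assumes "mat_subalgebra n U S"
    and "\<And>V. V \<subseteq> {1..n} \<Longrightarrow> adj_mat n U (tuple_of n V) \<in> S"
    and "\<And>V. V \<subseteq> {1..n} \<Longrightarrow> dual_idem n U x (tuple_of n V) \<in> S"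
  shows "T \<subseteq> S"
  unfolding terwilliger_alg_def
  by (rule hull_minimal) (use assms in \<open>auto simp: tuples01_eq\<close>)

lemma C_mat_in_T: "g \<in> tuples01 n \<Longrightarrow> C_mat n U x g \<in> T"
  unfolding C_mat_def B_mat_def
  by (intro pmat.subspace_sum pmat.subspace_scale T_subspace T_times dual_idem_in_T adj_mat_in_T)
    auto

lemma C_mat_in_center:
  assumes G: "G \<subseteq> {1..n}"
  shows "(C_mat n U x (tuple_of n G) :: ('u, 'f::field) pmat) \<in> mat_center n U T"
proof -
  let ?C = "C_mat n U x (tuple_of n G) :: ('u, 'f) pmat"
  have C: "?C \<in> T" by (intro C_mat_in_T tuple_of_in_tuples01)
  then have "?C \<in> mat_carrier n U" using T_carrier by auto
  then have "T \<subseteq> {N \<in> mat_carrier n U. ?C \<odot> N = N \<odot> ?C}"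
    using generators_in_carrier[of n U x, where ?'b = 'f]
    by (intro T_subsetI mat_subalgebra_centralizer)
      (auto simp: C_mat_commutes_adj_mat[OF G] C_mat_commutes_dual_idem[OF G] tuple_of_in_tuples01)
  then show ?thesis using C by (auto simp: mat_center_def)
qed

lemma center_subspace: "pmat.subspace (mat_center n U T)"
  using T_subspace unfolding pmat.subspace_def mat_center_def
  by (auto simp: mat_times_add mat_times_scale mat_times_zero)

section \<open>Invariance under coordinatewise permutations fixing the base point\<close>

definition act :: "(nat \<Rightarrow> 'u \<Rightarrow> 'u) \<Rightarrow> (nat \<Rightarrow> 'u) \<Rightarrow> nat \<Rightarrow> 'u" where
  "act \<pi> y = (\<lambda>a\<in>{1..n}. \<pi> a (y a))"

definition stabilizer :: "(nat \<Rightarrow> 'u \<Rightarrow> 'u) set" where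
  "stabilizer = {\<pi>. \<forall>a\<in>{1..n}. bij_betw (\<pi> a) (U a) (U a) \<and> \<pi> a (x a) = x a}"

lemma act_in_X: "\<pi> \<in> stabilizer \<Longrightarrow> y \<in> X \<Longrightarrow> act \<pi> y \<in> X"
  by (auto simp: act_def stabilizer_def points_def bij_betw_def)

lemma diff_set_act:
  assumes "\<pi> \<in> stabilizer" "y \<in> X" "z \<in> X"
  shows "diff_set n (act \<pi> y) (act \<pi> z) = diff_set n y z"
proof -
  have "\<pi> a (y a) = \<pi> a (z a) \<longleftrightarrow> y a = z a" if "a \<in> {1..n}" for a
  proof (rule inj_on_eq_iff)
    show "inj_on (\<pi> a) (U a)" using assms(1) that by (auto simp: stabilizer_def bij_betw_def)
  qed (use assms X_mem that in auto)
  then show ?thesis by (auto simp: diff_set_def act_def)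
qed

lemma support_act:
  assumes "\<pi> \<in> stabilizer" "y \<in> X"
  shows "support (act \<pi> y) = support y"
proof -
  have "act \<pi> x = x"
    using assms(1) base by (intro X_eqI act_in_X) (auto simp: act_def stabilizer_def)
  then show ?thesis using diff_set_act[OF assms(1) base assms(2)] by simp
qed

lemma act_eq_iff:
  assumes "\<pi> \<in> stabilizer" "y \<in> X" "z \<in> X"
  shows "act \<pi> y = act \<pi> z \<longleftrightarrow> y = z"
proof
  assume "act \<pi> y = act \<pi> z"
  then have "diff_set n y z = {}"
    using diff_set_act[OF assms] by (auto simp: diff_set_def)
  then show "y = z" using assms by (intro X_eqI) (auto simp: diff_set_def)
qed simp

lemma bij_act: "\<pi> \<in> stabilizer \<Longrightarrow> bij_betw (act \<pi>) X X"
  unfolding bij_betw_def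
  using finite_X act_in_X act_eq_iff by (metis endo_inj_surj image_subsetI inj_onI)

definition invariants :: "('u, 'f::field) pmat set" where
  "invariants = {M \<in> mat_carrier n U.
     \<forall>\<pi>\<in>stabilizer. \<forall>y\<in>X. \<forall>z\<in>X. M (act \<pi> y) (act \<pi> z) = M y z}"

text \<open>For products, the bijection \<open>act \<pi>\<close> of \<open>X\<close> reindexes the
  inner sum.\<close>

lemma mat_subalgebra_invariants: "mat_subalgebra n U (invariants :: ('u, 'f::field) pmat set)"
  unfolding mat_subalgebra_def pmat.subspace_def
proof (intro conjI ballI allI)
  fix M N :: "('u, 'f) pmat" assume MN: "M \<in> invariants" "N \<in> invariants"
  have "(M \<odot> N) (act \<pi> y) (act \<pi> z) = (M \<odot> N) y z"
    if "\<pi> \<in> stabilizer" "y \<in> X" "z \<in> X" for \<pi> y z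
  proof -
    have "(M \<odot> N) (act \<pi> y) (act \<pi> z) = (\<Sum>w\<in>X. M (act \<pi> y) (act \<pi> w) * N (act \<pi> w) (act \<pi> z))"
      unfolding mat_times_def by (rule sum.reindex_bij_betw[symmetric]) (rule bij_act[OF that(1)])
    also have "\<dots> = (M \<odot> N) y z"
      unfolding mat_times_def using MN that by (intro sum.cong) (auto simp: invariants_def)
    finally show ?thesis .
  qed
  then show "M \<odot> N \<in> invariants"
    using MN by (auto simp: invariants_def times_in_carrier)
qed (use mat_subalgebra_carrier[of n U, where ?'b = 'f] in
  \<open>auto simp: invariants_def mat_subalgebra_def pmat.subspace_def mat_scale_def mat_one_def
    act_in_X act_eq_iff\<close>)

text \<open>The entries of the generators depend only on equality of points, supports and difference
  sets, all of which the action preserves.\<close>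

lemma T_subset_invariants: "(T :: ('u, 'f::field) pmat set) \<subseteq> invariants"
  using generators_in_carrier[of n U x, where ?'b = 'f] mat_subalgebra_invariants
  by (intro T_subsetI)
    (auto simp: invariants_def tuple_of_in_tuples01 adj_mat_tuple_of dual_idem_tuple_of
      act_in_X diff_set_act support_act act_eq_iff)

section \<open>The block at the all-one tuple\<close>

text \<open>In each coordinate two transpositions suffice: the first sends \<open>y a\<close> to
  \<open>y' a\<close>, the second sends the image \<open>s a\<close> of \<open>z a\<close> to
  \<open>z' a\<close>. None of the points involved is \<open>x a\<close>.\<close>

lemma full_support_transitive:
  assumes X: "y \<in> X" "z \<in> X" "y' \<in> X" "z' \<in> X"
    and full: "support y = {1..n}" "support z = {1..n}" "support y' = {1..n}" "support z' = {1..n}"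
    and diff: "diff_set n y z = diff_set n y' z'"
  shows "\<exists>\<pi>\<in>stabilizer. act \<pi> y = y' \<and> act \<pi> z = z'"
proof -
  define s where "s a = transpose (y a) (y' a) (z a)" for a
  define \<pi> where "\<pi> a = transpose (s a) (z' a) \<circ> transpose (y a) (y' a)" for a
  have local: "bij_betw (\<pi> a) (U a) (U a) \<and> \<pi> a (x a) = x a \<and> \<pi> a (y a) = y' a \<and> \<pi> a (z a) = z' a"
    if a: "a \<in> {1..n}" for a
  proof -
    have U: "y a \<in> U a" "z a \<in> U a" "y' a \<in> U a" "z' a \<in> U a" using X X_mem a by auto
    then have s: "s a \<in> U a" by (auto simp: s_def transpose_def)
    have nx: "y a \<noteq> x a" "z a \<noteq> x a" "y' a \<noteq> x a" "z' a \<noteq> x a"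
      using full a by (metis diff_set_fullD)+
    have eq: "y a = z a \<longleftrightarrow> y' a = z' a"
      using diff a by (rule diff_set_eqD)
    have "bij_betw (\<pi> a) (U a) (U a)"
      unfolding \<pi>_def by (rule bij_betw_trans[of _ _ "U a"]) (use U s in simp_all)
    moreover have "\<pi> a (x a) = x a"
      using nx by (auto simp: \<pi>_def s_def transpose_def)
    \<comment> \<open>The second transposition leaves \<open>y' a\<close> in place:
      \<open>s a = y' a\<close> holds exactly when \<open>z a = y a\<close>, hence exactly when
      \<open>z' a = y' a\<close>, and then that transposition is the identity.\<close>
    moreover have "\<pi> a (y a) = y' a"
      using eq by (auto simp: \<pi>_def s_def transpose_def)
    moreover have "\<pi> a (z a) = z' a"
      by (simp add: \<pi>_def s_def)
    ultimately show ?thesis by simp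
  qed
  then have \<pi>: "\<pi> \<in> stabilizer" by (auto simp: stabilizer_def)
  moreover have "act \<pi> y = y'" "act \<pi> z = z'"
    using X local act_in_X[OF \<pi>] by (auto intro!: X_eqI simp: act_def)
  ultimately show ?thesis by blast
qed

text \<open>Each \<open>U a\<close> has a point other than \<open>x a\<close>; for
  \<open>a \<in> J\<close> there is room for a third point.\<close>

lemma full_support_pair_exists:
  assumes J: "J \<subseteq> large"
  shows "\<exists>y\<in>X. \<exists>z\<in>X. support y = {1..n} \<and> support z = {1..n} \<and> diff_set n y z = J"
proof -
  have "\<exists>s t. s \<in> U a \<and> t \<in> U a \<and> s \<noteq> x a \<and> t \<noteq> x a \<and> (s \<noteq> t \<longleftrightarrow> a \<in> J)"
    if a: "a \<in> {1..n}" for a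
  proof -
    note [simp] = fin[OF a]
    have "card (U a - {x a}) = card (U a) - 1" using X_mem[OF base a] by simp
    then have "card (U a - {x a}) > 0" using card_ge_2[OF a] by simp
    then obtain s where s: "s \<in> U a" "s \<noteq> x a" by (auto simp: card_gt_0_iff)
    show ?thesis
    proof (cases "a \<in> J")
      case True
      then have "card (U a) > 2" using J by (auto simp: big_def)
      then have "card (U a - {x a, s}) > 0"
        using diff_card_le_card_Diff[of "{x a, s}" "U a"] s by auto
      then obtain t where "t \<in> U a" "t \<noteq> x a" "t \<noteq> s" by (auto simp: card_gt_0_iff)
      then show ?thesis using s True by metis
    qed (use s in blast)
  qed
  then obtain s t where st: "\<And>a. a \<in> {1..n} \<Longrightarrow>
      s a \<in> U a \<and> t a \<in> U a \<and> s a \<noteq> x a \<and> t a \<noteq> x a \<and> (s a \<noteq> t a \<longleftrightarrow> a \<in> J)"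
    by metis
  define y where "y = restrict s {1..n}"
  define z where "z = restrict t {1..n}"
  have "y \<in> X" "z \<in> X" using st by (simp_all add: y_def z_def points_def)
  moreover have "support y = {1..n}" "support z = {1..n}"
    by (rule diff_set_eqI; use st in \<open>force simp: y_def z_def\<close>)+
  moreover have "diff_set n y z = J"
    by (rule diff_set_eqI) (use st J in \<open>auto simp: y_def z_def big_def\<close>)
  ultimately show ?thesis by blast
qed

text \<open>Where \<open>y\<close> and \<open>z\<close> differ, \<open>x a\<close>,
  \<open>y a\<close> and \<open>z a\<close> are three distinct points.\<close>

lemma diff_set_full_support_large:
  assumes X: "y \<in> X" "z \<in> X" and full: "support y = {1..n}" "support z = {1..n}"
  shows "diff_set n y z \<subseteq> large"
proof
  fix a assume a: "a \<in> diff_set n y z"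
  then have an: "a \<in> {1..n}" by (auto simp: diff_set_def)
  have "y a \<noteq> x a" "z a \<noteq> x a" using full an by (metis diff_set_fullD)+
  then have "card {x a, y a, z a} = 3" using a by (auto simp: diff_set_def)
  moreover have "{x a, y a, z a} \<subseteq> U a" using X base X_mem[OF _ an] by auto
  ultimately have "3 \<le> card (U a)" using card_mono[OF fin[OF an]] by metis
  then show "a \<in> large" using an by (auto simp: big_def)
qed

lemma large_subset: "large \<subseteq> {1..n}"
  by (auto simp: big_def)

text \<open>The valency factor is an empty product on this block, so the entry is 0 or 1 in every
  characteristic.\<close>

lemma C_mat_full_support:
  assumes "G \<subseteq> {1..n}" "y \<in> X" "z \<in> X" "support y = {1..n}" "support z = {1..n}"
  shows "C_mat n U x (tuple_of n G) y z = (if diff_set n y z \<subseteq> G then 1 else 0)"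
proof -
  have "G - {1..n} = {}" using assms by blast
  then have "(\<Prod>a\<in>G - {1..n}. card (U a) - 1) = 1" by (simp only: prod.empty)
  then show ?thesis using assms by (simp add: C_mat_entry del: of_nat_prod)
qed

text \<open>On this block, linear combinations become the superset sums treated by the inversion
  lemmas.\<close>

lemma C_combination_full_support:
  assumes "y \<in> X" "z \<in> X" "support y = {1..n}" "support z = {1..n}"
  shows "(\<Sum>G\<in>Pow large. mat_scale (c G) (C_mat n U x (tuple_of n G))) y z =
    (\<Sum>G | diff_set n y z \<subseteq> G \<and> G \<subseteq> large. c G)"
proof -
  have fin_large: "finite large" using large_subset finite_subset by blast
  have "(\<Sum>G\<in>Pow large. mat_scale (c G) (C_mat n U x (tuple_of n G))) y z =
      (\<Sum>G\<in>Pow large. if diff_set n y z \<subseteq> G then c G else 0)"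
    unfolding sum_fun_apply2 mat_scale_def using assms large_subset
    by (intro sum.cong) (auto simp: C_mat_full_support subset_trans)
  also have "\<dots> = (\<Sum>G | diff_set n y z \<subseteq> G \<and> G \<subseteq> large. c G)"
    using fin_large by (intro sum.mono_neutral_cong_right) auto
  finally show ?thesis .
qed

section \<open>Central elements are determined by the all-one block\<close>

text \<open>Multiplying by the idempotent of \<open>support y\<close> on the left keeps the entry at
  \<open>(y, z)\<close>; multiplying on the right kills it.\<close>

lemma center_block_diagonal:
  assumes M: "M \<in> mat_center n U T" and "y \<in> X" "z \<in> X" "support y \<noteq> support z"
  shows "M y z = 0"
proof -
  let ?D = "dual_idem n U x (tuple_of n (support y))"
  have "?D \<in> T" by (intro dual_idem_in_T tuple_of_in_tuples01)
  then have "(M \<odot> ?D) y z = (?D \<odot> M) y z" using M by (auto simp: mat_center_def)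
  then show ?thesis
    using assms by (simp add: times_dual_idem dual_idem_times diff_set_subset)
qed

text \<open>For a row \<open>w\<close> with support \<open>H\<close>, compare entries of \<open>N M = M N\<close> for
  \<open>N = E\<^sup>*\<^sub>1 A\<^sub>J E\<^sup>*\<^sub>H\<close> with \<open>J\<close> the complement of \<open>H\<close>: a row \<open>y\<close> of \<open>N\<close> extending \<open>w\<close> has
  its only nonzero entry at \<open>w\<close>.\<close>

lemma center_eq_zeroI:
  assumes M: "(M :: ('u, 'f::field) pmat) \<in> mat_center n U T"
    and zero: "\<And>y z. y \<in> X \<Longrightarrow> z \<in> X \<Longrightarrow> support y = {1..n} \<Longrightarrow> support z = {1..n} \<Longrightarrow> M y z = 0"
  shows "M = 0"
proof -
  have "M w z = 0" for w z
  proof (cases "w \<in> X \<and> z \<in> X \<and> support w = support z")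
    case False
    moreover have "M \<in> mat_carrier n U" using M T_carrier by (auto simp: mat_center_def)
    ultimately show ?thesis using center_block_diagonal[OF M, of w z]
      unfolding mat_carrier_def by blast
  next
    case True
    define H where "H = support w"
    let ?N = "dual_idem n U x (tuple_of n {1..n}) \<odot> adj_mat n U (tuple_of n ({1..n} - H))
      \<odot> dual_idem n U x (tuple_of n H) :: ('u, 'f) pmat"
    have H: "H \<subseteq> {1..n}" unfolding H_def by (rule diff_set_subset)
    note N = block_entry[OF subset_refl Diff_subset H]
    obtain e where e: "e \<in> X" "support e = {1..n}"
      using full_support_pair_exists[of "{}"] by auto
    \<comment> \<open>The row \<open>w\<close> equals \<open>x\<close> off \<open>H\<close>; filling
      in \<open>e\<close> there yields full support and changes \<open>w\<close> exactly off
      \<open>H\<close>.\<close>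
    define y where "y = (\<lambda>a\<in>{1..n}. if a \<in> H then w a else e a)"
    have y: "y \<in> X" using e True by (auto simp: y_def points_def PiE_mem)
    have e_ne: "e a \<noteq> x a" if "a \<in> {1..n}" for a
      using e(2) that by (metis diff_set_fullD)
    have sy: "support y = {1..n}"
      using e_ne by (fastforce simp: y_def diff_set_def H_def)
    have w_off: "w a = x a" if "a \<in> {1..n}" "a \<notin> H" for a
      using that by (auto simp: H_def diff_set_def)
    have dyw: "diff_set n y w = {1..n} - H"
      using e_ne w_off by (auto simp: y_def diff_set_def split: if_splits)
    have unique: "v = w" if "v \<in> X" "support v = H" "diff_set n y v = {1..n} - H" for v
    proof (rule X_eqI)
      fix a assume a: "a \<in> {1..n}"
      show "v a = w a"
      proof (cases "a \<in> H")
        case True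
        then have "a \<notin> diff_set n y v" using that by auto
        then show ?thesis using True a by (auto simp: diff_set_def y_def)
      next
        case False
        then have "a \<notin> support v" using that by auto
        then show ?thesis using w_off[OF a False] a by (auto simp: diff_set_def)
      qed
    qed (use that True in auto)
    have "(?N \<odot> M) y z = (\<Sum>v\<in>X. if v = w then M w z else 0)"
      unfolding mat_times_def[of n U ?N M]
    proof (intro sum.cong refl)
      fix v assume v: "v \<in> X"
      show "?N y v * M v z = (if v = w then M w z else 0)"
      proof (cases "v = w")
        case True
        then show ?thesis using v y sy dyw by (simp add: N H_def[symmetric])
      next
        case False
        then have "\<not> (support v = H \<and> diff_set n y v = {1..n} - H)" using unique[OF v] by blast
        then show ?thesis using False by (auto simp: N)
      qed
    qed
    then have NM: "(?N \<odot> M) y z = M w z" using True finite_X by simp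
    \<comment> \<open>A nonzero \<open>?N v z\<close> forces \<open>v\<close> to have full support,
      and then \<open>M y v\<close> is zero by assumption.\<close>
    have "(M \<odot> ?N) y z = 0"
      unfolding mat_times_def[of n U M ?N]
      using y sy zero by (intro sum.neutral) (auto simp: N)
    moreover have "?N \<in> T"
      by (intro T_times dual_idem_in_T adj_mat_in_T tuple_of_in_tuples01)
    ultimately show ?thesis using M NM by (auto simp: mat_center_def)
  qed
  then show ?thesis by (auto simp: fun_eq_iff)
qed

section \<open>Injectivity, independence and spanning\<close>

text \<open>At a full-support pair with difference set \<open>G\<close> the matrix of
  \<open>G\<close> has entry 1, so an equal matrix of \<open>G'\<close> requires
  \<open>G \<subseteq> G'\<close>; symmetry gives equality.\<close>

lemma inj_on_C_mat:
  "inj_on (\<lambda>G. C_mat n U x (tuple_of n G) :: ('u, 'f::field) pmat) (Pow large)"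
proof (rule inj_onI)
  have le: "G \<subseteq> G'" if G: "G \<subseteq> large" "G' \<subseteq> large"
    and eq: "C_mat n U x (tuple_of n G) = (C_mat n U x (tuple_of n G') :: ('u, 'f) pmat)" for G G'
  proof -
    obtain y z where yz: "y \<in> X" "z \<in> X" "support y = {1..n}" "support z = {1..n}" "diff_set n y z = G"
      using full_support_pair_exists[OF G(1)] by auto
    have sub: "G \<subseteq> {1..n}" "G' \<subseteq> {1..n}" using G large_subset by auto
    have "(if diff_set n y z \<subseteq> G' then 1 else 0 :: 'f) = (if diff_set n y z \<subseteq> G then 1 else 0)"
      using eq sub yz(1-4) by (metis C_mat_full_support)
    then show ?thesis using yz(5) by (auto split: if_splits)
  qed
  show "G = G'" if "G \<in> Pow large" "G' \<in> Pow large"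
    "C_mat n U x (tuple_of n G) = (C_mat n U x (tuple_of n G') :: ('u, 'f) pmat)" for G G'
    using le[of G G'] le[of G' G] that by auto
qed

text \<open>Evaluating a vanishing combination at a full-support pair with difference set
  \<open>J\<close>, for each \<open>J \<subseteq> large\<close>, makes all superset sums of the
  coefficients zero.\<close>

lemma independent_C_mats:
  "pmat.independent ((\<lambda>G. C_mat n U x (tuple_of n G) :: ('u, 'f::field) pmat) ` Pow large)"
    (is "pmat.independent (?C ` _)")
proof (rule pmat.independent_if_scalars_zero)
  have fin_large: "finite large" using large_subset finite_subset by blast
  then show "finite (?C ` Pow large)" by simp
  fix f M assume sum0: "(\<Sum>M\<in>?C ` Pow large. mat_scale (f M) M) = 0" and "M \<in> ?C ` Pow large"
  then obtain G where G: "G \<subseteq> large" "M = ?C G" by auto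
  have comb0: "(\<Sum>G\<in>Pow large. mat_scale (f (?C G)) (?C G)) = 0"
    using sum0 by (simp add: sum.reindex inj_on_C_mat)
  have "(\<Sum>G | J \<subseteq> G \<and> G \<subseteq> large. f (?C G)) = 0" if J: "J \<subseteq> large" for J
  proof -
    obtain y z where "y \<in> X" "z \<in> X" "support y = {1..n}" "support z = {1..n}" "diff_set n y z = J"
      using full_support_pair_exists[OF J] by auto
    then show ?thesis
      using C_combination_full_support[of y z "\<lambda>G. f (?C G)"] comb0 by simp
  qed
  then show "f M = 0"
    unfolding G(2) using G(1) fin_large
    by (intro superset_sums_zero_imp_zero[of large "\<lambda>G. f (?C G)"])
qed

lemma span_C_mats:
  "pmat.span ((\<lambda>G. C_mat n U x (tuple_of n G) :: ('u, 'f::field) pmat) ` Pow large)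
    = mat_center n U T" (is "pmat.span (?C ` _) = _")
proof
  show "pmat.span (?C ` Pow large) \<subseteq> mat_center n U T"
    using large_subset by (intro pmat.span_minimal center_subspace) (auto intro!: C_mat_in_center)
next
  have fin_large: "finite large" using large_subset finite_subset by blast
  show "mat_center n U T \<subseteq> pmat.span (?C ` Pow large)"
  proof
    fix M :: "('u, 'f) pmat" assume M: "M \<in> mat_center n U T"
    \<comment> \<open>The value of \<open>M\<close> at some full-support pair with difference set
      \<open>J\<close>; transitivity and invariance make it independent of the pair.\<close>
    define f where "f J = (SOME m. \<exists>y\<in>X. \<exists>z\<in>X. support y = {1..n} \<and> support z = {1..n} \<and>
      diff_set n y z = J \<and> m = M y z)" for J
    have f: "M y z = f (diff_set n y z)"
      if yz: "y \<in> X" "z \<in> X" "support y = {1..n}" "support z = {1..n}" for y z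
    proof -
      have "\<exists>m. \<exists>y'\<in>X. \<exists>z'\<in>X. support y' = {1..n} \<and> support z' = {1..n} \<and>
          diff_set n y' z' = diff_set n y z \<and> m = M y' z'"
        using yz by blast
      from someI_ex[OF this] obtain y' z' where yz':
        "y' \<in> X" "z' \<in> X" "support y' = {1..n}" "support z' = {1..n}"
        "diff_set n y' z' = diff_set n y z" "f (diff_set n y z) = M y' z'"
        unfolding f_def by blast
      obtain \<pi> where "\<pi> \<in> stabilizer" "act \<pi> y = y'" "act \<pi> z = z'"
        using full_support_transitive[of y z y' z'] yz yz' by auto
      moreover have "M \<in> invariants" using M T_subset_invariants by (auto simp: mat_center_def)
      ultimately show ?thesis using yz yz'(6) by (auto simp: invariants_def)
    qed
    obtain c where c: "\<And>J. J \<subseteq> large \<Longrightarrow> f J = (\<Sum>G | J \<subseteq> G \<and> G \<subseteq> large. c G)"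
      using superset_sum_inversion[OF fin_large, of f] by auto
    define S where "S = (\<Sum>G\<in>Pow large. mat_scale (c G) (?C G))"
    have S_span: "S \<in> pmat.span (?C ` Pow large)"
      unfolding S_def by (intro pmat.span_sum pmat.span_scale pmat.span_base) auto
    have "S \<in> mat_center n U T"
      unfolding S_def using large_subset
      by (intro pmat.subspace_sum pmat.subspace_scale center_subspace C_mat_in_center) auto
    \<comment> \<open>The coefficients \<open>c\<close> make \<open>S\<close> agree with
      \<open>M\<close> on the all-one block, so this central difference must vanish.\<close>
    then have "M - S \<in> mat_center n U T"
      using M by (intro pmat.subspace_diff center_subspace)
    moreover have "(M - S) y z = 0"
      if "y \<in> X" "z \<in> X" "support y = {1..n}" "support z = {1..n}" for y z
      using f[OF that] c[OF diff_set_full_support_large[OF that]]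
        C_combination_full_support[OF that, of c]
      by (simp add: S_def)
    ultimately have "M - S = 0" by (rule center_eq_zeroI)
    then show "M \<in> pmat.span (?C ` Pow large)" using S_span by simp
  qed
qed

end

section \<open>Index set and cardinality of the basis\<close>

text \<open>With both outer tuples equal to \<open>ones n\<close> the symmetric difference is empty,
  which leaves only the upper bound on \<open>supp n g\<close>.\<close>

lemma valid_triples_ones_iff:
  "(ones n, g, ones n) \<in> valid_triples n U \<longleftrightarrow> g \<in> tuple_of n ` Pow (big U {1..n})"
proof -
  have "ones n = tuple_of n {1..n}" by (auto simp: ones_def tuple_of_def fun_eq_iff)
  then have ones: "ones n \<in> tuples01 n" "supp n (ones n) = {1..n}"
    by (simp_all add: tuple_of_in_tuples01 supp_tuple_of)
  have sub: "big U {1..n} \<subseteq> {1..n}" by (auto simp: big_def)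
  have "(ones n, g, ones n) \<in> valid_triples n U \<longleftrightarrow> g \<in> tuples01 n \<and> supp n g \<subseteq> big U {1..n}"
    using ones by (simp add: valid_triples_def)
  also have "\<dots> \<longleftrightarrow> g \<in> tuple_of n ` Pow (big U {1..n})"
  proof
    assume "g \<in> tuples01 n \<and> supp n g \<subseteq> big U {1..n}"
    then show "g \<in> tuple_of n ` Pow (big U {1..n})" by (metis PowI imageI tuple_of_supp)
  next
    assume "g \<in> tuple_of n ` Pow (big U {1..n})"
    then obtain G where "G \<subseteq> big U {1..n}" "g = tuple_of n G" by auto
    then show "g \<in> tuples01 n \<and> supp n g \<subseteq> big U {1..n}"
      using sub by (auto simp: tuple_of_in_tuples01 supp_tuple_of subset_trans)
  qed
  finally show ?thesis .
qed

theorem theorem4p10: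
  fixes n :: nat and U :: "nat \<Rightarrow> 'u set" and x :: "nat \<Rightarrow> 'u"
    and \<C> :: "('u, 'f::field) pmat set"
  assumes "n \<ge> 1"
    and "\<And>h. h \<in> {1..n} \<Longrightarrow> finite (U h) \<and> card (U h) \<ge> 2"
    and "x \<in> points n U"
    and "\<C> = {C_mat n U x a | a. (ones n, a, ones n) \<in> valid_triples n U}"
  shows "pmat.independent \<C>
    \<and> pmat.span \<C> = mat_center n U (terwilliger_alg n U x)
    \<and> card \<C> = 2 ^ card {a \<in> {1..n}. card (U a) > 2}"
proof -
  interpret pointed_factorial_scheme n U x
    using assms(2,3) by unfold_locales auto
  have C: "\<C> = (\<lambda>G. C_mat n U x (tuple_of n G)) ` Pow large"
    unfolding assms(4) valid_triples_ones_iff by auto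
  have "card \<C> = card (Pow large)"
    unfolding C by (rule card_image) (rule inj_on_C_mat)
  also have "\<dots> = 2 ^ card {a \<in> {1..n}. card (U a) > 2}"
    by (simp add: card_Pow big_def)
  finally show ?thesis
    using independent_C_mats span_C_mats unfolding C by blast
qed

end
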